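(* Let $P, Q$ be nonzero real numbers with $\Delta := P^2 - 4Q > 0$, and let $(U_n)_{n\in\mathbb{Z}}$ and $\beta$ be as in the context. Let $(a_n)_{n \geq 1}$ be a sequence of positive integers tending to infinity with $n$, and let $k$ be a positive integer. Then the series on the left below converges and $$\sum_{n = 1}^{+\infty} Q^{a_n} \frac{U_{a_{n + k} - a_n}}{U_{a_n} U_{a_{n + k}}} = \sum_{n = 1}^{k} \frac{\beta^{a_n}}{U_{a_n}}.$$
   Context: $P, Q$ are fixed nonzero real numbers with $\Delta := P^2 - 4Q > 0$. $\alpha$ and $\beta$ denote the two real roots of $X^2 - PX + Q = 0$, labelled so that $|\alpha| > |\beta|$ (the absolute values are distinct because $P \neq 0$ and $\Delta > 0$). The Lucas sequence of the first kind $(U_n)_{n \in \mathbb{Z}}$ is defined by $U_0 = 0$, $U_1 = 1$ and $U_{n+2} = P U_{n+1} - Q U_n$ for all $n \in \mathbb{Z}$; equivalently $U_n = \frac{\alpha^n - \beta^n}{\alpha - \beta}$ for all $n\in\mathbb{Z}$. Infinite sums $\sum_{n=1}^{+\infty}$ are understood as limits of partial sums (absolute convergence is not claimed). *)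

theory Defs
  imports Complex_Main
begin

text \<open>The Lucas sequence of the first kind, indexed by the integers. For negative indices the
  recurrence \<open>U (n + 2) = P * U (n + 1) - Q * U n\<close> is solved for \<open>U n\<close>, which requires
  \<open>Q \<noteq> 0\<close>; see \<open>lucas_U_rec\<close> below.\<close>

function lucas_U :: "real \<Rightarrow> real \<Rightarrow> int \<Rightarrow> real" where
  "lucas_U P Q n =
    (if n = 0 then 0
     else if n = 1 then 1
     else if n > 1 then P * lucas_U P Q (n - 1) - Q * lucas_U P Q (n - 2)
     else (P * lucas_U P Q (n + 1) - lucas_U P Q (n + 2)) / Q)"
  by pat_completeness auto
termination
  by (relation "measure (\<lambda>(P, Q, n). nat \<bar>2 * n - 1\<bar>)") auto

declare lucas_U.simps [simp del]

lemma lucas_U_0 [simp]: "lucas_U P Q 0 = 0"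
  and lucas_U_1 [simp]: "lucas_U P Q 1 = 1"
  by (simp_all add: lucas_U.simps)

lemma lucas_U_rec:
  assumes "Q \<noteq> 0"
  shows "lucas_U P Q (n + 2) = P * lucas_U P Q (n + 1) - Q * lucas_U P Q n"
proof (cases "n \<ge> 0")
  case True
  then show ?thesis
    by (subst lucas_U.simps) (simp add: algebra_simps)
next
  case False
  then have "lucas_U P Q n = (P * lucas_U P Q (n + 1) - lucas_U P Q (n + 2)) / Q"
    by (subst lucas_U.simps) simp
  then show ?thesis
    using assms by simp
qed

end

theory Submission
  imports Defs
begin

text \<open>
  By the Binet formula, the summand is the difference of \<open>\<beta> ^ a n / U (a n)\<close> and
  \<open>\<beta> ^ a (n + k) / U (a (n + k))\<close>. The partial sums therefore telescope with step \<open>k\<close>, and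
  the \<open>k\<close> trailing terms vanish in the limit because \<open>\<beta> ^ m / U m\<close> tends to \<open>0\<close> when
  \<open>\<bar>\<beta>\<bar> < \<bar>\<alpha>\<bar>\<close>.
\<close>

text \<open>Both sides satisfy the same second-order recurrence and agree at 0 and 1. A two-sided
  induction on pairs of consecutive values covers all integers.\<close>

lemma lucas_U_binet:
  fixes \<alpha> \<beta> :: real
  assumes "\<alpha> \<noteq> 0" "\<beta> \<noteq> 0" "\<alpha> \<noteq> \<beta>"
  shows "lucas_U (\<alpha> + \<beta>) (\<alpha> * \<beta>) n = (\<alpha> powi n - \<beta> powi n) / (\<alpha> - \<beta>)"
proof -
  define U where "U = lucas_U (\<alpha> + \<beta>) (\<alpha> * \<beta>)"
  define V where "V n = (\<alpha> powi n - \<beta> powi n) / (\<alpha> - \<beta>)" for n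
  have U_rec: "U (n + 2) = (\<alpha> + \<beta>) * U (n + 1) - \<alpha> * \<beta> * U n" for n
    unfolding U_def using assms by (intro lucas_U_rec) simp
  have powi_rec: "x powi (n + 2) = (\<alpha> + \<beta>) * x powi (n + 1) - \<alpha> * \<beta> * x powi n"
    if "x = \<alpha> \<or> x = \<beta>" for x n
    using that assms by (auto simp: power_int_add power2_eq_square algebra_simps)
  have V_rec: "V (n + 2) = (\<alpha> + \<beta>) * V (n + 1) - \<alpha> * \<beta> * V n" for n
    unfolding V_def by (simp add: powi_rec right_diff_distrib diff_divide_distrib)
  have "U n = V n \<and> U (n + 1) = V (n + 1)"
  proof (induction n rule: int_induct[where k = 0])
    case base
    show ?case using assms by (simp add: U_def V_def)
  next
    case (step1 i)
    then show ?case using U_rec[of i] V_rec[of i] by (simp add: add.assoc)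
  next
    case (step2 i)
    \<comment> \<open>Downwards, the recurrence determines only
      \<open>\<alpha> * \<beta> * U (i - 1)\<close>; the nonzero factor is then cancelled.\<close>
    then have "\<alpha> * \<beta> * U (i - 1) = \<alpha> * \<beta> * V (i - 1)"
      using U_rec[of "i - 1"] V_rec[of "i - 1"] by (simp add: add.commute)
    with step2 show ?case using assms by simp
  qed
  then show ?thesis by (simp add: U_def V_def)
qed

text \<open>Raising \<open>N\<close> by one slides the window \<open>N + 1, ..., N + k\<close> by
  one place: it gains \<open>f (Suc N + k)\<close> and loses \<open>f (Suc N)\<close>. For
  \<open>N < k\<close> the two sums on the right overlap and the common terms cancel.\<close>

lemma sum_telescope_step:
  fixes f :: "nat \<Rightarrow> 'a :: ab_group_add"
  shows "(\<Sum>n=1..N. f n - f (n + k)) = (\<Sum>n=1..k. f n) - (\<Sum>n=1..k. f (N + n))"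
proof (induction N)
  case (Suc N)
  have shift: "(\<Sum>n=1..k. f (Suc N + n)) = (\<Sum>n=1..k. f (N + n)) + f (Suc N + k) - f (Suc N)"
    by (induction k) simp_all
  show ?case
    unfolding shift using Suc by (simp add: algebra_simps)
qed simp

text \<open>Through the Binet formula, this keeps the denominators \<open>U m\<close> with
  \<open>m > 0\<close> away from zero.\<close>

lemma power_neq_if_abs_less:
  fixes x y :: real
  assumes "\<bar>y\<bar> < \<bar>x\<bar>" "m > 0"
  shows "x ^ m \<noteq> y ^ m"
  using power_strict_mono[OF assms(1) abs_ge_zero assms(2)] by (auto simp flip: power_abs)

lemma power_div_power_diff_tendsto_0:
  fixes x y :: real
  assumes "\<bar>y\<bar> < \<bar>x\<bar>"
  shows "(\<lambda>m. y ^ m / (x ^ m - y ^ m)) \<longlonglongrightarrow> 0"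
proof -
  have "x \<noteq> 0" using assms by auto
  have "(\<lambda>m. (y / x) ^ m) \<longlonglongrightarrow> 0"
    using assms by (intro LIMSEQ_power_zero) (simp add: divide_less_eq_1)
  then have "(\<lambda>m. (y / x) ^ m / (1 - (y / x) ^ m)) \<longlonglongrightarrow> 0 / (1 - 0)"
    by (intro tendsto_divide tendsto_diff tendsto_const) auto
  \<comment> \<open>At \<open>m = 0\<close> both denominators vanish, and both quotients are 0 by
    convention.\<close>
  moreover have "(y / x) ^ m / (1 - (y / x) ^ m) = y ^ m / (x ^ m - y ^ m)" for m
    using \<open>x \<noteq> 0\<close> by (simp add: power_divide divide_simps)
  ultimately show ?thesis by simp
qed

theorem theorem2p1:
  fixes P Q \<alpha> \<beta> :: real
    and a :: "nat \<Rightarrow> nat"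
    and k :: nat
  assumes "P \<noteq> 0" and "Q \<noteq> 0" and "P\<^sup>2 - 4 * Q > 0"
    and "{x :: real. x\<^sup>2 - P * x + Q = 0} = {\<alpha>, \<beta>}" and "\<bar>\<alpha>\<bar> > \<bar>\<beta>\<bar>"
    and "\<And>n. n \<ge> 1 \<Longrightarrow> a n > 0"
    and "filterlim a at_top sequentially"
    and "k > 0"
  shows "(\<lambda>N. \<Sum>n=1..N. Q ^ a n * (lucas_U P Q (int (a (n + k)) - int (a n))
              / (lucas_U P Q (int (a n)) * lucas_U P Q (int (a (n + k))))))
         \<longlonglongrightarrow> (\<Sum>n=1..k. \<beta> ^ a n / lucas_U P Q (int (a n)))"
proof -
  have "\<alpha>\<^sup>2 - P * \<alpha> + Q = 0" "\<beta>\<^sup>2 - P * \<beta> + Q = 0"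
    using assms(4) by blast+
  note roots = this
  \<comment> \<open>Difference of the two root equations, factored.\<close>
  then have "(\<alpha> - \<beta>) * (\<alpha> + \<beta> - P) = 0" by algebra
  moreover have ne: "\<alpha> \<noteq> \<beta>" using assms(5) by auto
  ultimately have P: "P = \<alpha> + \<beta>" by simp
  with roots(1) have Q: "Q = \<alpha> * \<beta>" by algebra
  have nz: "\<alpha> \<noteq> 0" "\<beta> \<noteq> 0" using \<open>Q \<noteq> 0\<close> Q by auto
  have Q_power: "Q ^ m = \<alpha> ^ m * \<beta> ^ m" for m
    by (simp add: Q power_mult_distrib)
  note binet = lucas_U_binet[OF nz ne, folded P Q]
  define f where "f n = \<beta> ^ a n / lucas_U P Q (int (a n))" for n
  have summand: "Q ^ a n * (lucas_U P Q (int (a (n + k)) - int (a n))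
      / (lucas_U P Q (int (a n)) * lucas_U P Q (int (a (n + k))))) = f n - f (n + k)"
    if "n \<ge> 1" for n
  proof -
    have "\<alpha> ^ a n \<noteq> \<beta> ^ a n" "\<alpha> ^ a (n + k) \<noteq> \<beta> ^ a (n + k)"
      by (rule power_neq_if_abs_less[OF assms(5)], use assms(6) that in simp)+
    \<comment> \<open>With \<open>r = a n\<close> and \<open>s = a (n + k)\<close>, the numerator
      over the common denominator is \<open>\<beta>^r * (\<alpha>^s - \<beta>^s) - \<beta>^s *
      (\<alpha>^r - \<beta>^r) = \<beta>^r * \<alpha>^s - \<beta>^s * \<alpha>^r\<close>, which is
      \<open>Q^r * (\<alpha> powi (s - r) - \<beta> powi (s - r))\<close>. Since \<open>a\<close>
      may decrease, \<open>s - r\<close> can be negative.\<close>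
    then show ?thesis
      using nz ne
      by (simp add: f_def binet power_int_diff Q_power divide_simps) (simp add: algebra_simps)
  qed
  \<comment> \<open>The factor \<open>\<alpha> - \<beta>\<close> is the denominator in the Binet
    formula.\<close>
  have "(\<lambda>m. (\<alpha> - \<beta>) * (\<beta> ^ m / (\<alpha> ^ m - \<beta> ^ m))) \<longlonglongrightarrow> (\<alpha> - \<beta>) * 0"
    using assms(5) by (intro tendsto_intros power_div_power_diff_tendsto_0)
  then have "(\<lambda>m. \<beta> ^ m / lucas_U P Q (int m)) \<longlonglongrightarrow> 0"
    by (simp add: binet mult.commute)
  then have "f \<longlonglongrightarrow> 0"
    unfolding f_def using assms(7) by (rule filterlim_compose)
  \<comment> \<open>The trailing sum has a fixed number \<open>k\<close> of terms, each a shift of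
    the null sequence \<open>f\<close>.\<close>
  then have "(\<lambda>N. (\<Sum>n=1..k. f n) - (\<Sum>n=1..k. f (N + n))) \<longlonglongrightarrow> (\<Sum>n=1..k. f n) - (\<Sum>n=1..k. 0)"
    by (intro tendsto_intros LIMSEQ_ignore_initial_segment)
  then have "(\<lambda>N. \<Sum>n=1..N. f n - f (n + k)) \<longlonglongrightarrow> (\<Sum>n=1..k. f n)"
    unfolding sum_telescope_step by simp
  moreover have "(\<Sum>n=1..N. Q ^ a n * (lucas_U P Q (int (a (n + k)) - int (a n))
      / (lucas_U P Q (int (a n)) * lucas_U P Q (int (a (n + k)))))) = (\<Sum>n=1..N. f n - f (n + k))"
    for N
    by (intro sum.cong refl summand) simp
  ultimately show ?thesis
    by (simp only: f_def)
qed

end
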